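(* Let $\mathcal{A}$ be a Rickart *-ring ordered by $\preceq^{\alpha}$, where $\alpha\in\{r*|\square,\ \ell*|\square,\ *|\square\}$, and let $a,b\in\mathcal{A}$ be such that $a\preceq^{\alpha} b$. Then the poset $[a,b]^{\alpha}=\{x\in\mathcal{A}: a\preceq^{\alpha}x\preceq^{\alpha}b\}$ is order-isomorphic to the poset $[0,b-a]^{\alpha}=\{x\in\mathcal{A}: x\preceq^{\alpha} b-a\}$ (both ordered by $\preceq^{\alpha}$).
   Context: A *-ring is an (associative) ring $\mathcal{A}$ with an involution $*$: $(a+b)^*=a^*+b^*$, $(ab)^*=b^*a^*$, $(a^* )^*=a$. It is a Rickart *-ring if for every $a\in\mathcal{A}$ there is a self-adjoint idempotent $p$ (i.e. $p=p^*=p^2$) with $\{x\in\mathcal{A}: xa=0\}=\mathcal{A}(1-p)$; such a ring has an identity $1$, and $p$ is unique and denoted $\mathrm{lp}(a)$. Likewise, for every $a$ there is a unique self-adjoint idempotent $\mathrm{rp}(a)$ with $\{x\in\mathcal{A}: ax=0\}=(1-\mathrm{rp}(a))\mathcal{A}$. The following are partial orders on $\mathcal{A}$: $a\preceq^{r*|\square} b$ iff $a\,\mathrm{rp}(b)=a=b\,\mathrm{rp}(a)$ and $a^2=ab=ba$; $a\preceq^{\ell*|\square} b$ iff $\mathrm{lp}(a)b=a=\mathrm{lp}(b)a$ and $a^2=ab=ba$; $a\preceq^{*|\square} b$ iff $\mathrm{lp}(a)b=a=b\,\mathrm{rp}(a)$ and $a^2=ab=ba$. Two posets are order-isomorphic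 if there is a bijection between them which is order-preserving with order-preserving inverse. *)

theory Defs
  imports Main
begin

class star_ring = ring +
  fixes star :: "'a \<Rightarrow> 'a"
  assumes star_add: "star (x + y) = star x + star y"
    and star_mult: "star (x * y) = star y * star x"
    and star_star [simp]: "star (star x) = x"

definition projection :: "'a::star_ring \<Rightarrow> bool" where
  "projection p \<longleftrightarrow> p = star p \<and> p = p * p"

text \<open>
  The identity is that of \<^class>\<open>monoid_mult\<close> rather than \<^class>\<open>ring_1\<close>, because
  \<^class>\<open>ring_1\<close> would exclude the zero ring. It is part of the structure since the
  left ideal generated by \<open>1 - p\<close> refers to it.
\<close>

class rickart_star_ring = star_ring + monoid_mult +
  assumes rickart: "\<exists>p. p = star p \<and> p = p * p \<and> {x. x * a = 0} = {y * (1 - p) | y. True}"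

definition lp :: "'a::rickart_star_ring \<Rightarrow> 'a" where
  "lp a = (THE p. projection p \<and> {x. x * a = 0} = {y * (1 - p) | y. True})"

definition rp :: "'a::rickart_star_ring \<Rightarrow> 'a" where
  "rp a = (THE p. projection p \<and> {x. a * x = 0} = {(1 - p) * y | y. True})"

lemma star_zero [simp]: "star (0::'a::star_ring) = 0"
  using star_add [of 0 "0::'a"] by simp

lemma star_uminus: "star (- x) = - star (x::'a::star_ring)"
  using star_add [of x "- x"] by (simp add: eq_neg_iff_add_eq_0 add.commute)

lemma star_diff: "star (x - y) = star x - star (y::'a::star_ring)"
  using star_add [of x "- y"] by (simp add: star_uminus)

lemma star_one [simp]: "star (1::'a::rickart_star_ring) = 1"
  using star_mult [of "star 1" "1::'a"] by simp

lemma ex1_lp: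
  "\<exists>!p. projection p \<and> {x. x * a = 0} = {y * (1 - p) | y. True}"
  for a :: "'a::rickart_star_ring"
proof (rule ex_ex1I)
  show "\<exists>p. projection p \<and> {x. x * a = 0} = {y * (1 - p) | y. True}"
    using rickart [of a] unfolding projection_def by blast
next
  have absorb: "q = q * p"
    if p: "projection p" "{x. x * a = 0} = {y * (1 - p) | y. True}"
      and q: "projection q" "{x. x * a = 0} = {y * (1 - q) | y. True}" for p q
  proof -
    have "1 * (1 - p) \<in> {x. x * a = 0}"
      unfolding p(2) by blast
    then have "1 - p \<in> {y * (1 - q) | y. True}"
      unfolding q(2) by simp
    then obtain y where y: "1 - p = y * (1 - q)"
      by blast
    have "(1 - q) * q = 0"
      using q(1) by (simp add: projection_def left_diff_distrib)
    then have "(1 - p) * q = 0"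
      by (simp add: y mult.assoc)
    then have "q = p * q"
      by (simp add: left_diff_distrib)
    then have "star q = star (p * q)"
      by simp
    then show "q = q * p"
      using p(1) q(1) by (simp add: projection_def star_mult)
  qed
  fix p q
  assume p: "projection p \<and> {x. x * a = 0} = {y * (1 - p) | y. True}"
    and q: "projection q \<and> {x. x * a = 0} = {y * (1 - q) | y. True}"
  have qp: "q = q * p"
    by (rule absorb) (use p q in simp_all)
  have pq: "p = p * q"
    by (rule absorb) (use p q in simp_all)
  have "p = star (p * q)"
    using p pq by (simp add: projection_def)
  also have "\<dots> = q * p"
    using p q by (simp add: projection_def star_mult)
  finally show "p = q"
    using qp by simp
qed

lemma star_image_annihilator:
  fixes a p :: "'a::rickart_star_ring"
  assumes "projection p"
  shows "{x. a * x = 0} = {(1 - p) * y | y. True} \<longleftrightarrow>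
    {x. x * star a = 0} = {y * (1 - p) | y. True}"
proof -
  have ann: "{x. x * star a = 0} = star ` {x. a * x = 0}"
  proof (intro set_eqI iffI)
    fix x assume "x \<in> {x. x * star a = 0}"
    then have "star (x * star a) = 0"
      by simp
    then have "a * star x = 0"
      by (simp add: star_mult)
    then have "star (star x) \<in> star ` {x. a * x = 0}"
      by blast
    then show "x \<in> star ` {x. a * x = 0}"
      by simp
  next
    fix x assume "x \<in> star ` {x. a * x = 0}"
    then obtain z where z: "x = star z" "a * z = 0"
      by auto
    then show "x \<in> {x. x * star a = 0}"
      by (simp flip: star_mult)
  qed
  have sp: "star (1 - p) = 1 - p"
    using assms by (simp add: star_diff projection_def)
  have ideal: "{y * (1 - p) | y. True} = star ` {(1 - p) * y | y. True}"
  proof (intro set_eqI iffI)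
    fix x assume "x \<in> {y * (1 - p) | y. True}"
    then obtain y where "x = y * (1 - p)" by auto
    then have "x = star ((1 - p) * star y)" by (simp add: star_mult sp)
    then show "x \<in> star ` {(1 - p) * y | y. True}" by blast
  next
    fix x assume "x \<in> star ` {(1 - p) * y | y. True}"
    then show "x \<in> {y * (1 - p) | y. True}" by (auto simp: star_mult sp)
  qed
  have "inj (star :: 'a \<Rightarrow> 'a)"
    by (rule inj_on_inverseI [where g = star]) simp
  then show ?thesis
    unfolding ann ideal by (simp add: inj_image_eq_iff)
qed

lemma ex1_rp:
  "\<exists>!p. projection p \<and> {x. a * x = 0} = {(1 - p) * y | y. True}"
  for a :: "'a::rickart_star_ring"
proof -
  have "projection p \<and> {x. a * x = 0} = {(1 - p) * y | y. True} \<longleftrightarrow>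
      projection p \<and> {x. x * star a = 0} = {y * (1 - p) | y. True}" for p
    by (intro conj_cong refl star_image_annihilator)
  then show ?thesis
    using ex1_lp [of "star a"] by (simp only:)
qed

lemma lp: "projection (lp a)" "{x. x * a = 0} = {y * (1 - lp a) | y. True}"
  using theI' [OF ex1_lp [of a]] unfolding lp_def by blast+

lemma rp: "projection (rp a)" "{x. a * x = 0} = {(1 - rp a) * y | y. True}"
  using theI' [OF ex1_rp [of a]] unfolding rp_def by blast+

text \<open>
  The three indices stand for \<open>r*|\<box>\<close>, \<open>\<ell>*|\<box>\<close> and \<open>*|\<box>\<close> respectively.
\<close>

datatype star_order = RStar | LStar | Star

fun ord_le :: "star_order \<Rightarrow> 'a::rickart_star_ring \<Rightarrow> 'a \<Rightarrow> bool" where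
  "ord_le RStar a b \<longleftrightarrow> a * rp b = a \<and> a = b * rp a \<and> a * a = a * b \<and> a * b = b * a"
| "ord_le LStar a b \<longleftrightarrow> lp a * b = a \<and> a = lp b * a \<and> a * a = a * b \<and> a * b = b * a"
| "ord_le Star a b \<longleftrightarrow> lp a * b = a \<and> a = b * rp a \<and> a * a = a * b \<and> a * b = b * a"

definition interval :: "star_order \<Rightarrow> 'a::rickart_star_ring \<Rightarrow> 'a \<Rightarrow> 'a set" where
  "interval \<alpha> a b = {x. ord_le \<alpha> a x \<and> ord_le \<alpha> x b}"

definition initial_segment :: "star_order \<Rightarrow> 'a::rickart_star_ring \<Rightarrow> 'a set" where
  "initial_segment \<alpha> b = {x. ord_le \<alpha> x b}"

definition order_isomorphic ::
  "'a set \<Rightarrow> ('a \<Rightarrow> 'a \<Rightarrow> bool) \<Rightarrow> 'b set \<Rightarrow> ('b \<Rightarrow> 'b \<Rightarrow> bool) \<Rightarrow> bool" where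
  "order_isomorphic A leA B leB \<longleftrightarrow>
    (\<exists>f. bij_betw f A B \<and> monotone_on A leA leB f \<and> monotone_on B leB leA (the_inv_into A f))"

end

(* For each of the three orders, a \<le> b holds iff a is orthogonal to b - a, for a symmetric relation
   \<bottom> such that u \<bottom> v and a \<bottom> u + v imply a \<bottom> u and a + u \<bottom> v. Symmetry and this associativity law
   alone make x \<mapsto> x - a an order isomorphism from [a, b] onto [0, b - a]. *)

theory Submission
  imports Defs
begin

section \<open>Intervals translated along an orthogonality relation\<close>

lemma order_isomorphic_translation:
  fixes le orth :: "'a::ab_group_add \<Rightarrow> 'a \<Rightarrow> bool"
  assumes le_iff: "\<And>x y. le x y \<longleftrightarrow> orth x (y - x)"
    and sym: "\<And>x y. orth x y \<Longrightarrow> orth y x"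
    and assoc_l: "\<And>a u v. orth u v \<Longrightarrow> orth a (u + v) \<Longrightarrow> orth a u"
    and assoc_r: "\<And>a u v. orth u v \<Longrightarrow> orth a (u + v) \<Longrightarrow> orth (a + u) v"
    and "le a b"
  shows "order_isomorphic {x. le a x \<and> le x b} le {x. le x (b - a)} le"
proof -
  let ?A = "{x. le a x \<and> le x b}" and ?B = "{x. le x (b - a)}" and ?f = "\<lambda>x. x - a"
  have down: "le (x - a) (y - a)" if "le a x" "le x y" for x y
  proof -
    \<comment> \<open>By symmetry \<open>y - x\<close> is orthogonal to \<open>x\<close>, split here
      as \<open>(x - a) + a\<close> so that associativity can drop the summand
      \<open>a\<close>.\<close>
    have "orth (x - a) a" "orth (y - x) ((x - a) + a)"
      using that by (simp_all add: le_iff sym)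
    then have "orth (y - x) (x - a)"
      by (rule assoc_l)
    then show ?thesis
      by (simp add: le_iff sym)
  qed
  have up: "le a (a + u)" "le (a + u) (a + w)" if "le u w" "le a (a + w)" for u w
  proof -
    \<comment> \<open>Splitting \<open>w\<close> as \<open>u + (w - u)\<close> brings both
      hypotheses into the form that associativity requires.\<close>
    have *: "orth u (w - u)" "orth a (u + (w - u))"
      using that by (simp_all add: le_iff)
    show "le a (a + u)" "le (a + u) (a + w)"
      using assoc_l [OF *] assoc_r [OF *] by (simp_all add: le_iff)
  qed
  have inj: "inj_on ?f ?A"
    by (simp add: inj_on_def)
  have surj: "?f ` ?A = ?B"
  proof
    show "?f ` ?A \<subseteq> ?B"
      using down by auto
    show "?B \<subseteq> ?f ` ?A"
    proof
      fix u assume "u \<in> ?B"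
      then have "a + u \<in> ?A"
        using up [of u "b - a"] \<open>le a b\<close> by simp
      then show "u \<in> ?f ` ?A"
        by (intro rev_image_eqI [of "a + u"]) simp_all
    qed
  qed
  have inv: "the_inv_into ?A ?f u = a + u" if "u \<in> ?B" for u
  proof (rule the_inv_into_f_eq [OF inj])
    show "a + u \<in> ?A"
      using that up [of u "b - a"] \<open>le a b\<close> by simp
  qed simp
  have mono: "monotone_on ?A le le ?f"
    using down by (auto simp: monotone_on_def)
  have "monotone_on ?B le le (the_inv_into ?A ?f)"
  proof (rule monotone_onI)
    fix u w assume *: "u \<in> ?B" "w \<in> ?B" "le u w"
    \<comment> \<open>Translating \<open>le u w\<close> by \<open>a\<close> requires
      \<open>a \<le> a + w\<close>; this follows from \<open>w \<le> b - a\<close> and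
      \<open>a \<le> b\<close>.\<close>
    have "le a (a + w)"
      using up(1) [of w "b - a"] * \<open>le a b\<close> by simp
    then show "le (the_inv_into ?A ?f u) (the_inv_into ?A ?f w)"
      using up(2) * by (simp only: inv)
  qed
  with inj surj mono show ?thesis
    unfolding order_isomorphic_def bij_betw_def by blast
qed

section \<open>Annihilators, support projections and properness of the involution\<close>

lemma mult_lp_eq_0_iff: "x * lp a = 0 \<longleftrightarrow> x * a = 0"
  for a :: "'a::rickart_star_ring"
proof
  assume "x * lp a = 0"
  then have "x = x * (1 - lp a)"
    by (simp add: right_diff_distrib)
  then have "x \<in> {y * (1 - lp a) | y. True}"
    by blast
  then show "x * a = 0"
    using lp(2) [of a] by blast
next
  assume "x * a = 0"
  then have "x \<in> {y * (1 - lp a) | y. True}"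
    using lp(2) [of a] by blast
  then obtain y where "x = y * (1 - lp a)"
    by blast
  moreover have "lp a * lp a = lp a"
    using lp(1) [of a] by (simp add: projection_def)
  ultimately show "x * lp a = 0"
    by (simp add: mult.assoc left_diff_distrib)
qed

text \<open>The involution carries right annihilators to left ones, so \<open>rp a\<close> has the
  property that determines \<open>lp (star a)\<close>. This transfers facts about \<open>lp\<close>
  to \<open>rp\<close>.\<close>

lemma lp_star: "lp (star a) = rp a"
  for a :: "'a::rickart_star_ring"
proof -
  have "projection (rp a) \<and> {x. x * star a = 0} = {y * (1 - rp a) | y. True}"
    using rp [of a] star_image_annihilator [OF rp(1), of a a] by (simp only: simp_thms)
  then show ?thesis
    unfolding lp_def by (rule the1_equality [OF ex1_lp])
qed

lemma rp_star: "rp (star a) = lp a"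
  for a :: "'a::rickart_star_ring"
  using lp_star [of "star a"] by simp

lemma mult_rp_eq_0_iff: "x * rp a = 0 \<longleftrightarrow> x * star a = 0"
  for a :: "'a::rickart_star_ring"
  using mult_lp_eq_0_iff [of x "star a"] by (simp add: lp_star)

lemma star_lp [simp]: "star (lp a) = lp a"
  using lp(1) [of a] by (simp add: projection_def)

lemma star_rp [simp]: "star (rp a) = rp a"
  using rp(1) [of a] by (simp add: projection_def)

lemma star_eq_0_iff [simp]: "star x = 0 \<longleftrightarrow> x = (0::'a::star_ring)"
  by (metis star_star star_zero)

lemma star_eq_iff: "star x = star y \<longleftrightarrow> x = (y::'a::star_ring)"
  by (metis star_star)

lemma star_mult_star_eq_0_iff: "star x * star y = 0 \<longleftrightarrow> y * x = (0::'a::star_ring)"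
  by (simp flip: star_mult)

lemma lp_mult_eq_0_iff: "lp a * x = 0 \<longleftrightarrow> star a * x = 0"
  for a :: "'a::rickart_star_ring"
  using mult_lp_eq_0_iff [of "star x" a] star_mult [of "lp a" x] star_mult [of "star a" x]
  by (metis star_eq_0_iff star_lp star_star)

lemma rp_mult_eq_0_iff: "rp a * x = 0 \<longleftrightarrow> a * x = 0"
  for a :: "'a::rickart_star_ring"
  using lp_mult_eq_0_iff [of "star a" x] by (simp add: lp_star)

lemma mult_rp [simp]: "a * rp a = a"
  for a :: "'a::rickart_star_ring"
proof -
  have "rp a * (1 - rp a) = 0"
    using rp(1) [of a] by (simp add: projection_def right_diff_distrib)
  then have "a * (1 - rp a) = 0"
    by (simp only: rp_mult_eq_0_iff)
  then show ?thesis
    by (simp add: right_diff_distrib)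
qed

lemma lp_mult [simp]: "lp a * a = a"
  for a :: "'a::rickart_star_ring"
  by (metis mult_rp rp_star star_lp star_mult star_star)

text \<open>The involution is proper: \<open>w * star w = 0\<close> gives
  \<open>w * rp w = 0\<close>, and \<open>w * rp w\<close> is \<open>w\<close> itself.\<close>

lemma mult_star_self_eq_0_iff: "w * star w = 0 \<longleftrightarrow> w = 0"
  for w :: "'a::rickart_star_ring"
  using mult_rp_eq_0_iff [of w w] by auto

text \<open>Properness applied to \<open>x * u\<close>, since
  \<open>(x * u) * star (x * u) = (x * u * star u) * star x\<close>.\<close>

lemma mult_mult_star_cancel: "x * u * star u = 0 \<Longrightarrow> x * u = 0"
  for u :: "'a::rickart_star_ring"
  using mult_star_self_eq_0_iff [of "x * u"]
  by (metis mult.assoc mult_zero_left star_mult)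

text \<open>Multiplying by \<open>star u\<close> on the right removes \<open>v\<close> and leaves
  \<open>x * u * star u = 0\<close>, where \<open>star u\<close> cancels. This splits annihilation
  of an orthogonal sum into its summands.\<close>

lemma annihilates_left_summand:
  fixes u :: "'a::rickart_star_ring"
  assumes "x * (u + v) = 0" "v * star u = 0"
  shows "x * u = 0"
proof (rule mult_mult_star_cancel)
  have "x * u * star u = x * (u + v) * star u"
    using assms(2) by (simp add: distrib_left distrib_right mult.assoc)
  then show "x * u * star u = 0"
    using assms(1) by simp
qed

text \<open>The element \<open>1 - rp b\<close> lies in the right annihilator of \<open>b\<close>,
  and \<open>rp b\<close> kills that whole annihilator. The projection is thus traded for an
  inclusion of kernels.\<close>

lemma mult_rp_eq_left_iff: "a * rp b = a \<longleftrightarrow> (\<forall>x. b * x = 0 \<longrightarrow> a * x = 0)"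
  for a :: "'a::rickart_star_ring"
proof
  assume "a * rp b = a"
  then have "a * x = a * (rp b * x)" for x
    by (simp flip: mult.assoc)
  moreover have "rp b * x = 0" if "b * x = 0" for x
    using that by (simp add: rp_mult_eq_0_iff)
  ultimately show "\<forall>x. b * x = 0 \<longrightarrow> a * x = 0"
    by (metis mult_zero_right)
next
  assume "\<forall>x. b * x = 0 \<longrightarrow> a * x = 0"
  moreover have "b * (1 - rp b) = 0"
    by (simp add: right_diff_distrib)
  ultimately have "a * (1 - rp b) = 0"
    by blast
  then show "a * rp b = a"
    by (simp add: right_diff_distrib)
qed

text \<open>As \<open>a * rp a = a\<close>, the equation says that \<open>b - a\<close> annihilates
  \<open>rp a\<close>, equivalently \<open>star a\<close>.\<close>

lemma eq_mult_rp_iff: "a = b * rp a \<longleftrightarrow> (b - a) * star a = 0"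
  for a :: "'a::rickart_star_ring"
proof -
  have "a = b * rp a \<longleftrightarrow> (b - a) * rp a = 0"
    by (auto simp only: left_diff_distrib mult_rp right_minus_eq)
  then show ?thesis
    by (simp only: mult_rp_eq_0_iff)
qed

lemma lp_mult_eq_iff: "lp a * b = a \<longleftrightarrow> star a * (b - a) = 0"
  for a :: "'a::rickart_star_ring"
  using lp_mult_eq_0_iff [of a "b - a"] by (simp add: right_diff_distrib)

section \<open>The orders as orthogonality of \<open>a\<close> and \<open>b - a\<close>\<close>

definition orth_Star :: "'a::rickart_star_ring \<Rightarrow> 'a \<Rightarrow> bool" where
  "orth_Star a c \<longleftrightarrow> star a * c = 0 \<and> a * star c = 0 \<and> a * c = 0 \<and> c * a = 0"

text \<open>With \<open>b = a + c\<close>, the kernel inclusion encodes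
  \<open>a * rp b = a\<close>.\<close>

definition orth_RStar :: "'a::rickart_star_ring \<Rightarrow> 'a \<Rightarrow> bool" where
  "orth_RStar a c \<longleftrightarrow> a * star c = 0 \<and> a * c = 0 \<and> c * a = 0 \<and>
    (\<forall>x. (a + c) * x = 0 \<longrightarrow> a * x = 0)"

lemma mult_star_eq_0_commute: "a * star c = 0 \<longleftrightarrow> c * star a = (0::'a::star_ring)"
  using star_mult_star_eq_0_iff [of "star c" a] by simp

lemma star_mult_eq_0_commute: "star a * c = 0 \<longleftrightarrow> star c * a = (0::'a::star_ring)"
  using star_mult_star_eq_0_iff [of a "star c"] by simp

lemma mult_diff_eq_0_iff: "a * (b - a) = 0 \<longleftrightarrow> a * a = (a * b :: 'a::ring)"
  "(b - a) * a = 0 \<longleftrightarrow> a * a = b * a"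
  by (simp_all add: right_diff_distrib left_diff_distrib eq_commute [of "a * a"])

lemma ord_le_Star_iff: "ord_le Star a b \<longleftrightarrow> orth_Star a (b - a)"
  unfolding orth_Star_def ord_le.simps lp_mult_eq_iff eq_mult_rp_iff
    mult_star_eq_0_commute [of a] mult_diff_eq_0_iff by argo

lemma ord_le_RStar_iff: "ord_le RStar a b \<longleftrightarrow> orth_RStar a (b - a)"
  unfolding orth_RStar_def ord_le.simps mult_rp_eq_left_iff eq_mult_rp_iff
    mult_star_eq_0_commute [of a] mult_diff_eq_0_iff add_diff_cancel_left' diff_add_cancel
    add.commute [of a "b - a"] by argo

text \<open>The involution reverses products and exchanges \<open>lp\<close> with \<open>rp\<close>,
  so the left order needs no separate orthogonality theory.\<close>

lemma ord_le_LStar_iff_RStar: "ord_le LStar a b \<longleftrightarrow> ord_le RStar (star a) (star b)"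
proof -
  have "star a * rp (star b) = star a \<longleftrightarrow> a = lp b * a"
    by (metis rp_star star_eq_iff star_lp star_mult)
  moreover have "star a = star b * rp (star a) \<longleftrightarrow> lp a * b = a"
    by (metis rp_star star_eq_iff star_lp star_mult)
  moreover have "star a * star a = star a * star b \<longleftrightarrow> a * a = b * a"
    "star a * star b = star b * star a \<longleftrightarrow> b * a = a * b"
    by (simp_all add: star_eq_iff flip: star_mult)
  ultimately show ?thesis
    unfolding ord_le.simps by argo
qed

section \<open>Symmetry and associativity of orthogonality\<close>

lemma orth_Star_sym: "orth_Star a c \<Longrightarrow> orth_Star c a"
  by (simp add: orth_Star_def mult_star_eq_0_commute [of c] star_mult_eq_0_commute [of c])

text \<open>The kernel condition is symmetric because \<open>(a + c) * x = 0\<close> and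
  \<open>a * x = 0\<close> force \<open>c * x = 0\<close>.\<close>

lemma orth_RStar_sym: "orth_RStar a c \<Longrightarrow> orth_RStar c a"
  unfolding orth_RStar_def
  by (metis add.commute add_0_left distrib_right mult_star_eq_0_commute)

text \<open>Since \<open>u\<close> and \<open>v\<close> are *-orthogonal on both sides, whatever
  annihilates \<open>u + v\<close> from either side annihilates each summand; the conditions on
  \<open>a\<close> and \<open>u + v\<close> split accordingly.\<close>

lemma orth_Star_assoc:
  assumes uv: "orth_Star u v" and a: "orth_Star a (u + v)"
  shows "orth_Star a u" "orth_Star (a + u) v"
proof -
  have left: "x * u = 0" "x * v = 0" if "x * (u + v) = 0" for x
    using that uv orth_Star_sym [OF uv] annihilates_left_summand [of x u v]
      annihilates_left_summand [of x v u]
    by (simp_all add: orth_Star_def add.commute)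
  have right: "u * x = 0" "v * x = 0" if "(u + v) * x = 0" for x
  proof -
    \<comment> \<open>Applying the involution reduces the right-hand case to splitting a left
      annihilator of \<open>star u + star v\<close>.\<close>
    have "star x * (star u + star v) = 0" "star x * (star v + star u) = 0"
      using that by (simp_all add: add.commute flip: star_mult star_add)
    moreover have "star v * u = 0" "star u * v = 0"
      using uv orth_Star_sym [OF uv] by (simp_all add: orth_Star_def)
    ultimately have "star x * star u = 0" "star x * star v = 0"
      using annihilates_left_summand [of "star x" "star u" "star v"]
        annihilates_left_summand [of "star x" "star v" "star u"] by simp_all
    then show "u * x = 0" "v * x = 0"
      by (simp_all add: star_mult_star_eq_0_iff)
  qed
  have "star a * (u + v) = 0" "a * (u + v) = 0" "(u + v) * star a = 0" "(u + v) * a = 0"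
    using a orth_Star_sym [OF a] by (simp_all add: orth_Star_def)
  then have "star a * u = 0" "star a * v = 0" "a * u = 0" "a * v = 0"
    "u * star a = 0" "v * star a = 0" "u * a = 0" "v * a = 0"
    by (blast intro: left right)+
  then show "orth_Star a u" "orth_Star (a + u) v"
    using uv by (simp_all add: orth_Star_def mult_star_eq_0_commute [of a]
        star_add distrib_left distrib_right)
qed

lemma orth_RStar_assoc:
  assumes uv: "orth_RStar u v" and a: "orth_RStar a (u + v)"
  shows "orth_RStar a u" "orth_RStar (a + u) v"
proof -
  have "a * (u + v) = 0" "u * star v = 0" "v * star u = 0"
    using a uv orth_RStar_sym [OF uv] by (simp_all add: orth_RStar_def)
  then have au: "a * u = 0" and av: "a * v = 0"
    using annihilates_left_summand [of a u v] annihilates_left_summand [of a v u]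
    by (simp_all add: add.commute)
  have right: "u * x = 0" "v * x = 0" if "(u + v) * x = 0" for x
    using that uv orth_RStar_sym [OF uv] by (simp_all add: orth_RStar_def add.commute)
  have "(u + v) * star a = 0" "(u + v) * a = 0"
    using a orth_RStar_sym [OF a] by (simp_all add: orth_RStar_def)
  then have "u * star a = 0" and va': "v * star a = 0" and ua: "u * a = 0" and va: "v * a = 0"
    by (blast intro: right)+
  then have au': "a * star u = 0" and av': "a * star v = 0"
    by (simp_all add: mult_star_eq_0_commute [of a])
  have sum: "a * x = 0" if "(a + u + v) * x = 0" for x
    using that a by (simp add: orth_RStar_def add.assoc)
  have "a * x = 0" if "(a + u) * x = 0" for x
  proof -
    \<comment> \<open>Replacing \<open>x\<close> by its part killed by \<open>v\<close> changes neither \<open>a * x\<close> nor \<open>u * x\<close>.\<close>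
    let ?y = "(1 - rp v) * x"
    have "a * rp v = 0" "u * rp v = 0"
      using av' \<open>u * star v = 0\<close> by (simp_all add: mult_rp_eq_0_iff)
    then have y: "a * ?y = a * x" "u * ?y = u * x" "v * ?y = 0"
      by (simp_all add: right_diff_distrib flip: mult.assoc)
    have "(a + u + v) * ?y = (a + u) * x"
      by (simp only: distrib_right y) simp
    then have "a * ?y = 0"
      using that by (intro sum) simp
    then show ?thesis
      by (simp only: y)
  qed
  then show "orth_RStar a u"
    using au ua au' by (simp add: orth_RStar_def)
  \<comment> \<open>First \<open>a * x = 0\<close> by \<open>sum\<close>; then
    \<open>(u + v) * x = 0\<close> remains, and \<open>right\<close> yields
    \<open>u * x = 0\<close>.\<close>
  have "(a + u) * x = 0" if "(a + u + v) * x = 0" for x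
    using sum [OF that] that right(1) [of x] by (simp add: distrib_right)
  then show "orth_RStar (a + u) v"
    using uv av va av' by (simp add: orth_RStar_def distrib_left distrib_right)
qed

theorem proposition34:
  fixes a b :: "'a::rickart_star_ring"
    and \<alpha> :: star_order
  assumes "ord_le \<alpha> a b"
  shows "order_isomorphic (interval \<alpha> a b) (ord_le \<alpha>)
           (initial_segment \<alpha> (b - a)) (ord_le \<alpha>)"
proof (cases \<alpha>)
  case RStar
  show ?thesis
    unfolding interval_def initial_segment_def RStar
    using ord_le_RStar_iff orth_RStar_sym orth_RStar_assoc assms [unfolded RStar]
    by (rule order_isomorphic_translation)
next
  case LStar
  \<comment> \<open>Pulling \<open>orth_RStar\<close> back along the additive map
    \<open>star\<close> preserves symmetry and associativity.\<close>
  let ?orth = "\<lambda>x y :: 'a. orth_RStar (star x) (star y)"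
  have le_iff: "ord_le LStar x y \<longleftrightarrow> ?orth x (y - x)" for x y :: 'a
    by (simp only: ord_le_LStar_iff_RStar ord_le_RStar_iff star_diff)
  have assoc: "?orth c u" "?orth (c + u) v" if "?orth u v" "?orth c (u + v)" for c u v
    using that orth_RStar_assoc [of "star u" "star v" "star c"] by (simp_all only: star_add)
  show ?thesis
    unfolding interval_def initial_segment_def LStar
    using le_iff orth_RStar_sym assoc assms [unfolded LStar]
    by (rule order_isomorphic_translation)
next
  case Star
  show ?thesis
    unfolding interval_def initial_segment_def Star
    using ord_le_Star_iff orth_Star_sym orth_Star_assoc assms [unfolded Star]
    by (rule order_isomorphic_translation)
qed

end
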